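(* Let $p$ be a prime number, let $\beta$ be an irrational real number, and let $D_n$ denote the denominator of its $n$th convergent. Let $H\ge1$ be an absolute constant and let $a:\mathbb{Z}_{\ge1}\to\mathbb{Z}_{\ge1}$ be a function such that $$\lim_{n\to\infty}\frac{p^{a(n)}}{D_n}=0$$ and, for some $n_0\ge1$, the conditions $$p^{a(n)}<D_n,\qquad3\cdot4^2H^2D_{n+1}<D_n^2$$ hold for all $n\ge n_0$. Suppose further that there exist an increasing infinite sequence $(n_k)_{k\ge1}$ of positive integers and, for each $k$, an integer vector $(x_k,z_k,v_k)\in\mathbb{Z}^3$ with $$x_kp^{a(n_k)}=z_kD_{n_k}+v_kD_{n_k+1},\qquad z_k\ge0,\ v_k\ge0,\ z_k+v_k\ge1,$$ $$1\le\max\{|x_k|,|z_k|,|v_k|\}\le H\cdot J_p(a(n_k),n_k).$$ Then $p$ and $\beta$ satisfy the $p$-adic Littlewood conjecture, i.e. $\liminf_{q\to\infty}q\,|q|_p\,\|q\beta\|=0$.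
   Context: For real $x$, $\|x\|:=\min_{k\in\mathbb{Z}}|x-k|$; $|\cdot|_p$ is the $p$-adic absolute value normalized by $|p|_p=1/p$; $q$ ranges over positive integers. For an irrational $\beta=[d_0;d_1,d_2,\ldots]$ (simple continued fraction, $d_0\in\mathbb{Z}$, $d_n\in\mathbb{Z}_{\ge1}$ for $n\ge1$), the denominators of the convergents are given by $D_0=1$, $D_1=d_1$, $D_{n+2}=d_{n+2}D_{n+1}+D_n$. For $m,n\ge1$, $J_p(m,n):=\left\lfloor(p^m+D_n+D_{n+1})^{1/2}\right\rfloor$. *)

theory Defs
  imports Complex_Main "HOL-Library.Extended_Real" "HOL-Computational_Algebra.Primes"
begin

definition dist_int :: "real \<Rightarrow> real" where
  "dist_int x = (INF k::int. \<bar>x - of_int k\<bar>)"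

text \<open>The infimum in \<^const>\<open>dist_int\<close> is a minimum.\<close>

lemma dist_int_attained: "\<exists>k::int. dist_int x = \<bar>x - of_int k\<bar>"
proof -
  have le: "\<bar>x - of_int (round x)\<bar> \<le> \<bar>x - of_int k\<bar>" for k :: int
    using round_diff_minimal[of x k] by simp
  have "dist_int x = \<bar>x - of_int (round x)\<bar>"
    unfolding dist_int_def
    by (rule cInf_eq_minimum) (use le in auto)
  then show ?thesis by blast
qed

definition padic_abs :: "nat \<Rightarrow> nat \<Rightarrow> real" where
  "padic_abs p q = (if q = 0 then 0 else 1 / real p ^ multiplicity p q)"

text \<open>
  The complete quotients of the simple continued fraction expansion
  \<open>\<beta> = [d\<^sub>0; d\<^sub>1, d\<^sub>2, \<dots>]\<close>.  For irrational \<open>\<beta>\<close> the division never degenerates.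
\<close>

primrec cf_quot :: "real \<Rightarrow> nat \<Rightarrow> real" where
  "cf_quot \<beta> 0 = \<beta>"
| "cf_quot \<beta> (Suc n) = 1 / frac (cf_quot \<beta> n)"

definition cf_coeff :: "real \<Rightarrow> nat \<Rightarrow> int" where
  "cf_coeff \<beta> n = \<lfloor>cf_quot \<beta> n\<rfloor>"

fun cf_denom :: "real \<Rightarrow> nat \<Rightarrow> int" where
  "cf_denom \<beta> 0 = 1"
| "cf_denom \<beta> (Suc 0) = cf_coeff \<beta> 1"
| "cf_denom \<beta> (Suc (Suc n)) =
     cf_coeff \<beta> (Suc (Suc n)) * cf_denom \<beta> (Suc n) + cf_denom \<beta> n"

lemma cf_quot_irrational: "\<beta> \<notin> \<rat> \<Longrightarrow> cf_quot \<beta> n \<notin> \<rat>"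
proof (induction n)
  case (Suc n)
  show ?case
  proof
    assume "cf_quot \<beta> (Suc n) \<in> \<rat>"
    then have "inverse (cf_quot \<beta> (Suc n)) \<in> \<rat>" by (rule Rats_inverse)
    then have "frac (cf_quot \<beta> n) + of_int \<lfloor>cf_quot \<beta> n\<rfloor> \<in> \<rat>"
      by (intro Rats_add) (simp_all add: field_simps)
    with Suc show False by (simp add: frac_def)
  qed
qed simp

lemma cf_coeff_pos:
  assumes "\<beta> \<notin> \<rat>" and "n \<ge> 1"
  shows "cf_coeff \<beta> n \<ge> 1"
proof -
  obtain m where n: "n = Suc m" using assms(2) by (cases n) auto
  have "cf_quot \<beta> m \<notin> \<int>"
    using cf_quot_irrational[OF assms(1), of m] Ints_subset_Rats by blast
  then have "frac (cf_quot \<beta> m) > 0" by (simp add: frac_gt_0_iff)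
  moreover have "frac (cf_quot \<beta> m) < 1" by (rule frac_lt_1)
  ultimately have "cf_quot \<beta> n \<ge> 1" by (simp add: n)
  then show ?thesis by (simp add: cf_coeff_def le_floor_iff)
qed

definition J :: "real \<Rightarrow> nat \<Rightarrow> nat \<Rightarrow> nat \<Rightarrow> int" where
  "J \<beta> p m n = \<lfloor>sqrt (real p ^ m + of_int (cf_denom \<beta> n) + of_int (cf_denom \<beta> (n + 1)))\<rfloor>"

text \<open>
  The limit inferior is taken in the extended reals; the index \<open>q = 0\<close> does not affect it.
\<close>

definition padic_littlewood :: "nat \<Rightarrow> real \<Rightarrow> bool" where
  "padic_littlewood p \<beta> \<longleftrightarrow>
     liminf (\<lambda>q::nat. ereal (real q * padic_abs p q * dist_int (real q * \<beta>))) = 0"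

end

theory Submission imports Defs begin

text \<open>
  Put \<open>q = x\<^sub>k p\<^sup>a = z\<^sub>k D\<^sub>n + v\<^sub>k D\<^sub>n\<^sub>+\<^sub>1\<close> with \<open>n = n\<^sub>k\<close> and \<open>a = a(n)\<close>.  Then \<open>q |q|\<^sub>p \<le> x\<^sub>k\<close>,
  while \<open>\<parallel>D\<^sub>n \<beta>\<parallel> \<le> 1 / D\<^sub>n\<^sub>+\<^sub>1\<close> yields \<open>\<parallel>q \<beta>\<parallel> \<le> (z\<^sub>k + v\<^sub>k) / D\<^sub>n\<^sub>+\<^sub>1\<close>.
  Bounding \<open>z\<^sub>k + v\<^sub>k\<close> by \<open>H J\<close> would not suffice, but the linear equation gives
  \<open>(z\<^sub>k + v\<^sub>k) D\<^sub>n \<le> x\<^sub>k p\<^sup>a\<close>.  Since \<open>x\<^sub>k\<^sup>2 \<le> H\<^sup>2 J\<^sup>2 \<le> 3 H\<^sup>2 D\<^sub>n\<^sub>+\<^sub>1\<close>, the product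
  \<open>q |q|\<^sub>p \<parallel>q \<beta>\<parallel>\<close> is at most \<open>3 H\<^sup>2 p\<^sup>a / D\<^sub>n\<close>, which tends to \<open>0\<close>.
\<close>

section \<open>Distance to the nearest integer and the p-adic absolute value\<close>

lemma dist_int_le: "dist_int x \<le> \<bar>x - of_int k\<bar>"
  unfolding dist_int_def by (rule cINF_lower) (auto intro!: bdd_belowI[of _ 0])

lemma dist_int_nonneg: "dist_int x \<ge> 0"
  using dist_int_attained[of x] by auto

lemma padic_abs_nonneg: "padic_abs p q \<ge> 0"
  by (simp add: padic_abs_def)

text \<open>Divisibility by \<open>p ^ m\<close> bounds the multiplicity only from below, hence an
  inequality: the cofactor of \<open>p ^ m\<close> may contain further factors
  \<open>p\<close>.\<close>

lemma padic_abs_le: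
  assumes "prime p" "q > 0" "p ^ m dvd q"
  shows "padic_abs p q \<le> 1 / real p ^ m"
proof -
  have "m \<le> multiplicity p q"
    using assms by (intro multiplicity_geI) auto
  with assms show ?thesis
    using prime_ge_1_nat[of p]
    by (auto simp: padic_abs_def intro!: divide_left_mono power_increasing)
qed

section \<open>Complete quotients and growth of the denominators\<close>

lemma cf_quot_gt_1:
  assumes "\<beta> \<notin> \<rat>"
  shows "cf_quot \<beta> (Suc n) > 1"
proof -
  have "cf_quot \<beta> n \<notin> \<int>"
    using cf_quot_irrational[OF assms, of n] Ints_subset_Rats by blast
  then show ?thesis
    using frac_lt_1[of "cf_quot \<beta> n"] by (simp add: frac_gt_0_iff)
qed

text \<open>The next complete quotient is the reciprocal of the fractional part; the convention
  \<open>1 / 0 = 0\<close> covers a vanishing fractional part.\<close>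

lemma cf_coeff_eq:
  "of_int (cf_coeff \<beta> n) = cf_quot \<beta> n - 1 / cf_quot \<beta> (Suc n)"
  by (simp add: cf_coeff_def frac_def)

lemma cf_denom_pos:
  assumes "\<beta> \<notin> \<rat>"
  shows "cf_denom \<beta> n \<ge> 1"
proof (induction n rule: induct_nat_012)
  case 1
  show ?case using cf_coeff_pos[OF assms, of 1] by simp
next
  case (ge2 n)
  have "1 * 1 \<le> cf_coeff \<beta> (Suc (Suc n)) * cf_denom \<beta> (Suc n)"
    using ge2 cf_coeff_pos[OF assms, of "Suc (Suc n)"] by (intro mult_mono) auto
  with ge2 show ?case by simp
qed simp

lemma cf_denom_add_le:
  assumes "\<beta> \<notin> \<rat>"
  shows "cf_denom \<beta> (Suc n) + cf_denom \<beta> n \<le> cf_denom \<beta> (Suc (Suc n))"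
proof -
  have "1 * cf_denom \<beta> (Suc n) \<le> cf_coeff \<beta> (Suc (Suc n)) * cf_denom \<beta> (Suc n)"
    using cf_coeff_pos[OF assms, of "Suc (Suc n)"] cf_denom_pos[OF assms, of "Suc n"]
    by (intro mult_right_mono) auto
  then show ?thesis by simp
qed

lemma cf_denom_Suc_ge:
  assumes "\<beta> \<notin> \<rat>"
  shows "cf_denom \<beta> n \<le> cf_denom \<beta> (Suc n)"
proof (cases n)
  case 0
  then show ?thesis using cf_denom_pos[OF assms, of 1] by simp
next
  case (Suc m)
  then show ?thesis
    using cf_denom_add_le[OF assms, of m] cf_denom_pos[OF assms, of m]
    by (simp del: cf_denom.simps)
qed

text \<open>From index 1 on, each step adds at least the previous denominator, hence at least 1.
  This crude growth later makes the integers \<open>q\<close> arbitrarily large.\<close>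

lemma cf_denom_ge_index:
  assumes "\<beta> \<notin> \<rat>"
  shows "int n \<le> cf_denom \<beta> n"
proof (induction n rule: induct_nat_012)
  case 1
  show ?case using cf_denom_pos[OF assms, of 1] by simp
next
  case (ge2 n)
  then show ?case
    using cf_denom_add_le[OF assms, of n] cf_denom_pos[OF assms, of n] by linarith
qed simp

section \<open>Approximation error of the convergents\<close>

text \<open>Multiplying the identity by the next complete quotient and replacing the current one by
  its partial quotient plus the reciprocal of the next turns the left side into the same expression
  one index later, by the recurrence of the denominators.\<close>

lemma cf_denom_quot_prod:
  assumes "\<beta> \<notin> \<rat>"
  shows "cf_quot \<beta> (Suc (Suc n)) * of_int (cf_denom \<beta> (Suc n)) + of_int (cf_denom \<beta> n)
    = (\<Prod>i\<le>Suc n. cf_quot \<beta> (Suc i))"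
proof (induction n)
  case 0
  have "cf_quot \<beta> (Suc (Suc 0)) \<noteq> 0"
    using cf_quot_gt_1[OF assms, of "Suc 0"] by linarith
  then show ?case
    using cf_coeff_eq[of \<beta> 1]
    by (simp add: field_simps del: cf_quot.simps)
next
  case (Suc n)
  have nz: "cf_quot \<beta> (Suc (Suc (Suc n))) \<noteq> 0"
    using cf_quot_gt_1[OF assms, of "Suc (Suc n)"] by linarith
  have "(\<Prod>i\<le>Suc (Suc n). cf_quot \<beta> (Suc i)) =
      cf_quot \<beta> (Suc (Suc (Suc n))) *
      (cf_quot \<beta> (Suc (Suc n)) * of_int (cf_denom \<beta> (Suc n)) + of_int (cf_denom \<beta> n))"
    unfolding Suc.IH by (simp del: cf_quot.simps)
  also have "\<dots> = cf_quot \<beta> (Suc (Suc (Suc n))) * of_int (cf_denom \<beta> (Suc (Suc n)))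
      + of_int (cf_denom \<beta> (Suc n))"
    using nz by (simp add: cf_coeff_eq[of \<beta> "Suc (Suc n)"] field_simps del: cf_quot.simps)
  finally show ?case by simp
qed

text \<open>Replacing the last partial quotient by its complete quotient only enlarges the
  recurrence, and the enlarged value is the product by \<open>cf_denom_quot_prod\<close>.\<close>

lemma cf_denom_le_quot_prod:
  assumes "\<beta> \<notin> \<rat>"
  shows "of_int (cf_denom \<beta> (Suc n)) \<le> (\<Prod>i\<le>n. cf_quot \<beta> (Suc i))"
proof (cases n)
  case 0
  then show ?thesis by (simp add: cf_coeff_def del: cf_quot.simps)
next
  case (Suc m)
  have "of_int (cf_coeff \<beta> (Suc n)) * of_int (cf_denom \<beta> n)
      \<le> cf_quot \<beta> (Suc n) * of_int (cf_denom \<beta> n)"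
    using cf_denom_pos[OF assms, of n]
    by (intro mult_right_mono) (auto simp: cf_coeff_def simp del: cf_quot.simps)
  then show ?thesis
    using cf_denom_quot_prod[OF assms, of m] Suc by (simp del: cf_quot.simps)
qed

text \<open>The integer \<open>c\<close> is the numerator of the convergent:
  \<lfloor>\<beta>\<rfloor>, then \<open>cf_coeff \<beta> 1 * \<lfloor>\<beta>\<rfloor> + 1\<close>,
  then given by the recurrence of the denominators. The errors satisfy this recurrence too, which
  yields the product formula.\<close>

lemma cf_approx_error:
  assumes "\<beta> \<notin> \<rat>"
  shows "\<exists>c::int. of_int (cf_denom \<beta> n) * \<beta> - of_int c
    = (-1) ^ n / (\<Prod>i\<le>n. cf_quot \<beta> (Suc i))"
proof (induction n rule: induct_nat_012)
  case 0
  show ?case by (intro exI[of _ "\<lfloor>\<beta>\<rfloor>"]) (simp add: frac_def)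
next
  case 1
  define q where "q = cf_quot \<beta>"
  have nz: "q (Suc 0) \<noteq> 0" "q (Suc (Suc 0)) \<noteq> 0"
    unfolding q_def using cf_quot_gt_1[OF assms, of 0] cf_quot_gt_1[OF assms, of "Suc 0"]
    by linarith+
  have frac: "\<beta> - of_int \<lfloor>\<beta>\<rfloor> = 1 / q (Suc 0)"
    by (simp add: q_def frac_def)
  have "of_int (cf_coeff \<beta> 1) * (\<beta> - of_int \<lfloor>\<beta>\<rfloor>) - 1
      = - (1 / (q (Suc 0) * q (Suc (Suc 0))))"
    unfolding frac cf_coeff_eq q_def[symmetric] using nz by (simp add: field_simps)
  then show ?case
    by (intro exI[of _ "cf_coeff \<beta> 1 * \<lfloor>\<beta>\<rfloor> + 1"])
      (simp add: q_def[symmetric] algebra_simps del: cf_quot.simps)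
next
  case (ge2 n)
  define q where "q = cf_quot \<beta>"
  define P where "P = (\<Prod>i\<le>n. q (Suc i))"
  have "q (Suc i) > 0" for i
    unfolding q_def using cf_quot_gt_1[OF assms, of i] by linarith
  then have nz: "P \<noteq> 0" "q (Suc i) \<noteq> 0" for i
    unfolding P_def by (simp_all add: less_imp_neq[symmetric])
  from ge2 obtain c c' where c: "of_int (cf_denom \<beta> n) * \<beta> - of_int c = (-1) ^ n / P"
    and c': "of_int (cf_denom \<beta> (Suc n)) * \<beta> - of_int c' = - ((-1) ^ n / (P * q (Suc (Suc n))))"
    unfolding P_def q_def by (auto simp del: cf_quot.simps)
  define d where "d = (of_int (cf_coeff \<beta> (Suc (Suc n))) :: real)"
  have d: "d = q (Suc (Suc n)) - 1 / q (Suc (Suc (Suc n)))"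
    unfolding d_def q_def by (rule cf_coeff_eq)
  have "of_int (cf_denom \<beta> (Suc (Suc n))) * \<beta> - of_int (cf_coeff \<beta> (Suc (Suc n)) * c' + c)
      = d * (of_int (cf_denom \<beta> (Suc n)) * \<beta> - of_int c')
        + (of_int (cf_denom \<beta> n) * \<beta> - of_int c)"
    by (simp add: d_def algebra_simps)
  \<comment> \<open>The two errors have opposite signs. Their combination is
    \<open>(-1) ^ n / P\<close> times \<open>1 - d / q (Suc (Suc n))\<close>, and by the formula for
    \<open>d\<close> this factor is the reciprocal of the product of the two new quotients.\<close>
  also have "\<dots> = (-1) ^ n / (P * q (Suc (Suc n)) * q (Suc (Suc (Suc n))))"
    unfolding c c' d using nz by (simp add: field_simps)
  also have "\<dots> = (-1) ^ Suc (Suc n) / (\<Prod>i\<le>Suc (Suc n). q (Suc i))"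
    by (simp add: P_def)
  finally show ?case unfolding q_def by blast
qed

lemma cf_denom_approx:
  assumes "\<beta> \<notin> \<rat>"
  obtains c :: int
  where "\<bar>of_int (cf_denom \<beta> n) * \<beta> - of_int c\<bar> \<le> 1 / of_int (cf_denom \<beta> (Suc n))"
proof -
  obtain c :: int where c: "of_int (cf_denom \<beta> n) * \<beta> - of_int c
      = (-1) ^ n / (\<Prod>i\<le>n. cf_quot \<beta> (Suc i))"
    using cf_approx_error[OF assms] by blast
  have D: "0 < (of_int (cf_denom \<beta> (Suc n)) :: real)"
    using cf_denom_pos[OF assms, of "Suc n"] by linarith
  note le = cf_denom_le_quot_prod[OF assms, of n]
  have "\<bar>of_int (cf_denom \<beta> n) * \<beta> - of_int c\<bar> = 1 / (\<Prod>i\<le>n. cf_quot \<beta> (Suc i))"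
    unfolding c using less_le_trans[OF D le]
    by (simp add: abs_divide power_abs del: cf_quot.simps)
  also have "\<dots> \<le> 1 / of_int (cf_denom \<beta> (Suc n))"
    using D le by (intro divide_left_mono mult_pos_pos) (auto simp del: cf_quot.simps)
  finally show ?thesis by (rule that)
qed

section \<open>The product bound from one solution of the linear equation\<close>

lemma dist_int_cf_combination:
  fixes z v :: int
  assumes "\<beta> \<notin> \<rat>" "z \<ge> 0" "v \<ge> 0"
  shows "dist_int (of_int (z * cf_denom \<beta> n + v * cf_denom \<beta> (Suc n)) * \<beta>)
    \<le> of_int (z + v) / of_int (cf_denom \<beta> (Suc n))"
proof -
  let ?D = "\<lambda>n. of_int (cf_denom \<beta> n) :: real"
  obtain c :: int where c: "\<bar>?D n * \<beta> - of_int c\<bar> \<le> 1 / ?D (Suc n)"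
    using cf_denom_approx[OF assms(1)] by blast
  obtain c' :: int where c': "\<bar>?D (Suc n) * \<beta> - of_int c'\<bar> \<le> 1 / ?D (Suc (Suc n))"
    using cf_denom_approx[OF assms(1)] by blast
  have pos: "?D m > 0" for m
    using cf_denom_pos[OF assms(1), of m] by linarith
  \<comment> \<open>Weakening the better estimate for the larger denominator gives both terms the
    common bound \<open>1 / ?D (Suc n)\<close>.\<close>
  have "1 / ?D (Suc (Suc n)) \<le> 1 / ?D (Suc n)"
    using cf_denom_Suc_ge[OF assms(1), of "Suc n"] pos
    by (intro divide_left_mono mult_pos_pos) (auto simp del: cf_denom.simps)
  with c' have c': "\<bar>?D (Suc n) * \<beta> - of_int c'\<bar> \<le> 1 / ?D (Suc n)" by linarith
  have "dist_int (of_int (z * cf_denom \<beta> n + v * cf_denom \<beta> (Suc n)) * \<beta>)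
      \<le> \<bar>of_int (z * cf_denom \<beta> n + v * cf_denom \<beta> (Suc n)) * \<beta> - of_int (z * c + v * c')\<bar>"
    by (rule dist_int_le)
  also have "\<dots> = \<bar>of_int z * (?D n * \<beta> - of_int c) + of_int v * (?D (Suc n) * \<beta> - of_int c')\<bar>"
    by (simp add: algebra_simps del: cf_denom.simps)
  also have "\<dots> \<le> of_int z * \<bar>?D n * \<beta> - of_int c\<bar> + of_int v * \<bar>?D (Suc n) * \<beta> - of_int c'\<bar>"
    using assms by (intro order.trans[OF abs_triangle_ineq]) (simp add: abs_mult)
  also have "\<dots> \<le> of_int z * (1 / ?D (Suc n)) + of_int v * (1 / ?D (Suc n))"
    using assms c c' by (intro add_mono mult_left_mono) auto
  finally show ?thesis by (simp add: add_divide_distrib)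
qed

lemma padic_littlewood_product_le:
  fixes x z v :: int and H :: real
  assumes "prime p" "\<beta> \<notin> \<rat>"
    and eq: "x * int p ^ m = z * cf_denom \<beta> n + v * cf_denom \<beta> (Suc n)"
    and zv: "z \<ge> 0" "v \<ge> 0" "z + v \<ge> 1"
    and pm: "real p ^ m < of_int (cf_denom \<beta> n)"
    and x: "of_int \<bar>x\<bar> \<le> H * of_int (J \<beta> p m n)"
  obtains q :: nat where "int q \<ge> cf_denom \<beta> n"
    and "real q * padic_abs p q * dist_int (real q * \<beta>)
      \<le> 3 * H\<^sup>2 * (real p ^ m / of_int (cf_denom \<beta> n))"
proof -
  define D where "D = (of_int (cf_denom \<beta> n) :: real)"
  define D' where "D' = (of_int (cf_denom \<beta> (Suc n)) :: real)"
  have D: "D \<ge> 1" "D \<le> D'" and D': "D' \<ge> 1"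
    using cf_denom_pos[OF assms(2), of n] cf_denom_pos[OF assms(2), of "Suc n"]
      cf_denom_Suc_ge[OF assms(2), of n] unfolding D_def D'_def by linarith+
  have p: "p > 0" using assms(1) by (rule prime_gt_0_nat)
  \<comment> \<open>The truncation by \<open>nat\<close> is harmless: the inequalities that follow
    give \<open>x * int p ^ m\<close> \<ge> \<open>cf_denom \<beta> n\<close> \<ge> 1. They also
    force \<open>x > 0\<close>.\<close>
  define q where "q = nat (x * int p ^ m)"
  have "(z + v) * cf_denom \<beta> n \<le> x * int p ^ m"
    unfolding eq distrib_right using zv cf_denom_Suc_ge[OF assms(2), of n]
    by (intro add_mono mult_left_mono) auto
  moreover have "1 * cf_denom \<beta> n \<le> (z + v) * cf_denom \<beta> n"
    using zv cf_denom_pos[OF assms(2), of n] by (intro mult_right_mono) auto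
  ultimately have le: "(z + v) * cf_denom \<beta> n \<le> x * int p ^ m" "cf_denom \<beta> n \<le> x * int p ^ m"
    by linarith+
  have q: "int q = x * int p ^ m" "int q \<ge> cf_denom \<beta> n" "q > 0"
    using le(2) cf_denom_pos[OF assms(2), of n] by (auto simp: q_def)
  have qr: "real q = of_int x * real p ^ m"
    using arg_cong[OF q(1), of "of_int :: int \<Rightarrow> real"] by simp
  have "x > 0"
    using q p zero_less_mult_pos2[of x "int p ^ m"] by simp
  have "p ^ m dvd q"
    using q(1) by (metis dvd_triv_right int_dvd_int_iff of_nat_power)
  then have "real q * padic_abs p q \<le> real q * (1 / real p ^ m)"
    using padic_abs_le[OF assms(1) q(3)] by (intro mult_left_mono) auto
  also have "\<dots> = of_int x" using p by (simp add: qr)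
  finally have A: "real q * padic_abs p q \<le> of_int x" .
  have B: "dist_int (real q * \<beta>) \<le> of_int (z + v) / D'"
    using dist_int_cf_combination[OF assms(2) zv(1,2), of n] q(1) eq
    unfolding D'_def by (metis of_int_of_nat_eq)
  have "of_int (z + v) * D \<le> of_int x * real p ^ m"
    using le(1) unfolding D_def
    by (metis of_int_le_iff of_int_mult of_int_of_nat_eq of_int_power)
  then have zvD: "of_int (z + v) \<le> of_int x * real p ^ m / D"
    using D by (simp add: field_simps)
  have "J \<beta> p m n \<le> sqrt (real p ^ m + D + D')"
    unfolding J_def D_def D'_def by simp
  \<comment> \<open>Each of the three summands is at most \<open>D'\<close>, because
    \<open>real p ^ m < D\<close> and \<open>D \<le> D'\<close>.\<close>
  also have "\<dots> \<le> sqrt (3 * D')"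
    using pm D unfolding D_def[symmetric] by (intro real_sqrt_le_mono) linarith
  finally have J: "J \<beta> p m n \<le> sqrt (3 * D')" .
  \<comment> \<open>Squaring the upper bound for \<open>J\<close> requires nonnegativity.\<close>
  have "J \<beta> p m n \<ge> 0"
    unfolding J_def using D D' by (simp add: D_def D'_def del: cf_denom.simps)
  then have "(of_int (J \<beta> p m n))\<^sup>2 \<le> 3 * D'"
    using J D' power_mono[OF J, of 2] by simp
  moreover have "(of_int x)\<^sup>2 \<le> (H * of_int (J \<beta> p m n))\<^sup>2"
    using x \<open>x > 0\<close> by (intro power_mono) auto
  ultimately have x2: "(of_int x)\<^sup>2 \<le> H\<^sup>2 * (3 * D')"
    by (smt (verit) mult_left_mono power_mult_distrib zero_le_power2)
  have "real q * padic_abs p q * dist_int (real q * \<beta>) \<le> of_int x * (of_int (z + v) / D')"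
    using A B \<open>x > 0\<close> by (intro mult_mono) (auto simp: dist_int_nonneg padic_abs_nonneg)
  also have "\<dots> \<le> of_int x * (of_int x * real p ^ m / D / D')"
    using zvD \<open>x > 0\<close> D' by (intro mult_left_mono divide_right_mono) auto
  also have "\<dots> = (of_int x)\<^sup>2 * (real p ^ m / (D * D'))"
    by (simp add: power2_eq_square)
  \<comment> \<open>The factor \<open>D'\<close> from the bound on the square of \<open>x\<close>
    cancels the \<open>D'\<close> from the distance estimate, leaving only
    \<open>real p ^ m / D\<close>.\<close>
  also have "\<dots> \<le> H\<^sup>2 * (3 * D') * (real p ^ m / (D * D'))"
    using x2 D D' by (intro mult_right_mono) auto
  also have "\<dots> = 3 * H\<^sup>2 * (real p ^ m / D)"
    using D' by (simp add: field_simps)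
  finally show ?thesis using that q(2) unfolding D_def by blast
qed

section \<open>Passage to the limit inferior\<close>

text \<open>One small value beyond every \<open>M\<close> already makes the infimum of each tail at
  most every positive \<open>e\<close>; values in between may be large. This suits a bound available
  only along a sparse sequence of \<open>q\<close>.\<close>

lemma liminf_ereal_eq_0I:
  fixes f :: "nat \<Rightarrow> real"
  assumes nonneg: "\<And>n. f n \<ge> 0"
    and small: "\<And>e M. e > 0 \<Longrightarrow> \<exists>n\<ge>M. f n \<le> e"
  shows "liminf (\<lambda>n. ereal (f n)) = 0"
proof (rule antisym)
  show "liminf (\<lambda>n. ereal (f n)) \<le> 0"
    unfolding liminf_SUP_INF
  proof (rule SUP_least)
    fix M
    show "(INF n\<in>{M..}. ereal (f n)) \<le> 0"
    proof (rule ereal_le_epsilon2)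
      fix e :: real
      assume "0 < e"
      then obtain n where "n \<ge> M" "f n \<le> e" using small by blast
      then show "(INF n\<in>{M..}. ereal (f n)) \<le> 0 + ereal e"
        by (intro INF_lower2[of n]) auto
    qed
  qed
  show "0 \<le> liminf (\<lambda>n. ereal (f n))"
    by (rule Liminf_bounded) (simp add: nonneg)
qed

lemma strict_mono_on_ge_index:
  fixes N :: "nat \<Rightarrow> nat"
  assumes "strict_mono_on {1..} N" "k \<ge> 1" "N 1 \<ge> 1"
  shows "k \<le> N k"
  using assms(2)
proof (induction k rule: dec_induct)
  case (step k)
  have "N k < N (Suc k)"
    using step by (intro strict_mono_onD[OF assms(1)]) auto
  with step show ?case by simp
qed (use assms in simp)

theorem theorem21:
  fixes p :: nat and \<beta> H :: real and a N :: "nat \<Rightarrow> nat" and x z v :: "nat \<Rightarrow> int"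
  assumes "prime p"
    and "\<beta> \<notin> \<rat>"
    and "H \<ge> 1"
    and "\<forall>n\<ge>1. a n \<ge> 1"
    and "(\<lambda>n. real p ^ a n / of_int (cf_denom \<beta> n)) \<longlonglongrightarrow> 0"
    and "\<exists>n0\<ge>1. \<forall>n\<ge>n0.
           real p ^ a n < of_int (cf_denom \<beta> n) \<and>
           3 * 4 ^ 2 * H ^ 2 * of_int (cf_denom \<beta> (n + 1)) < (of_int (cf_denom \<beta> n)) ^ 2"
    and "strict_mono_on {1..} N"
    and "\<forall>k\<ge>1. N k \<ge> 1"
    and "\<forall>k\<ge>1.
           x k * int p ^ a (N k) = z k * cf_denom \<beta> (N k) + v k * cf_denom \<beta> (N k + 1) \<and>
           z k \<ge> 0 \<and> v k \<ge> 0 \<and> z k + v k \<ge> 1 \<and>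
           1 \<le> Max {\<bar>x k\<bar>, \<bar>z k\<bar>, \<bar>v k\<bar>} \<and>
           of_int (Max {\<bar>x k\<bar>, \<bar>z k\<bar>, \<bar>v k\<bar>}) \<le> H * of_int (J \<beta> p (a (N k)) (N k))"
  shows "padic_littlewood p \<beta>"
proof -
  let ?f = "\<lambda>q::nat. real q * padic_abs p q * dist_int (real q * \<beta>)"
  obtain n0 where n0: "\<And>n. n \<ge> n0 \<Longrightarrow> real p ^ a n < of_int (cf_denom \<beta> n)"
    using assms(6) by blast
  have small: "\<exists>q\<ge>M. ?f q \<le> e" if "e > 0" for e :: real and M :: nat
  proof -
    have "(\<lambda>n. 3 * H\<^sup>2 * (real p ^ a n / of_int (cf_denom \<beta> n))) \<longlonglongrightarrow> 3 * H\<^sup>2 * 0"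
      by (intro tendsto_mult_left assms(5))
    then have "eventually (\<lambda>n. 3 * H\<^sup>2 * (real p ^ a n / of_int (cf_denom \<beta> n)) < e) sequentially"
      using that by (intro order_tendstoD(2)) simp_all
    then obtain n1 where
      n1: "\<And>n. n \<ge> n1 \<Longrightarrow> 3 * H\<^sup>2 * (real p ^ a n / of_int (cf_denom \<beta> n)) < e"
      by (auto simp: eventually_sequentially)
    \<comment> \<open>The summand 1 puts \<open>k\<close> in the index range of \<open>N\<close>. As
      \<open>N k \<ge> k\<close>, the index \<open>n\<close> passes the thresholds for
      \<open>real p ^ a n < cf_denom \<beta> n\<close> and for the error \<open>e\<close>, and also
      reaches \<open>M\<close>.\<close>
    define k where "k = 1 + n0 + n1 + M"
    define n where "n = N k"
    have "k \<ge> 1" by (simp add: k_def)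
    have "n \<ge> k"
      unfolding n_def using strict_mono_on_ge_index[OF assms(7) \<open>k \<ge> 1\<close>] assms(8) by simp
    then have n: "n \<ge> n0" "n \<ge> n1" "n \<ge> M" by (auto simp: k_def)
    have sol: "x k * int p ^ a n = z k * cf_denom \<beta> n + v k * cf_denom \<beta> (Suc n)"
      "z k \<ge> 0" "v k \<ge> 0" "z k + v k \<ge> 1"
      and M: "of_int (Max {\<bar>x k\<bar>, \<bar>z k\<bar>, \<bar>v k\<bar>}) \<le> H * of_int (J \<beta> p (a n) n)"
      using assms(9) \<open>k \<ge> 1\<close> by (auto simp: n_def simp del: cf_denom.simps Max_insert)
    have "\<bar>x k\<bar> \<le> Max {\<bar>x k\<bar>, \<bar>z k\<bar>, \<bar>v k\<bar>}" by simp
    then have "of_int \<bar>x k\<bar> \<le> H * of_int (J \<beta> p (a n) n)"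
      using M by (meson of_int_le_iff order.trans)
    then obtain q :: nat where q: "int q \<ge> cf_denom \<beta> n"
      "?f q \<le> 3 * H\<^sup>2 * (real p ^ a n / of_int (cf_denom \<beta> n))"
      using padic_littlewood_product_le[OF assms(1,2) sol n0[OF n(1)]] by blast
    \<comment> \<open>The chain is \<open>q\<close> \<ge> \<open>cf_denom \<beta> n\<close> \<ge>
      \<open>n\<close> \<ge> \<open>M\<close>.\<close>
    have "q \<ge> M"
      using q(1) n(3) cf_denom_ge_index[OF assms(2), of n] by linarith
    with q(2) n1[OF n(2)] show ?thesis by (meson less_imp_le order.trans)
  qed
  show ?thesis
    unfolding padic_littlewood_def
    using small by (intro liminf_ereal_eq_0I) (auto simp: dist_int_nonneg padic_abs_nonneg)
qed

end
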